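(* Let $G=(V,E)$ be a graph, $X,Y\subseteq V$ and $k\in\mathbb{N}$, $k\geq 1$. The number of leftmost $(X,Y,\leq k)^G$-separators is at most $C_{k-1}$, and the number of important $(X,Y,\leq k)^G$-separators is at most $\sum_{i=0}^{k-1}C_i$. Furthermore, both upper bounds are tight: for every $k$ there exist a graph $G$ and sets $X,Y$ for which the number of leftmost $(X,Y,\leq k)^G$-separators equals $C_{k-1}$, and there exist a graph $G$ and sets $X,Y$ for which the number of important $(X,Y,\leq k)^G$-separators equals the stated bound.
   Context: $C_n=\frac{1}{n+1}\binom{2n}{n}$ is the $n$-th Catalan number. A set $S\subseteq V$ is an $(X,Y)^G$-separator if $G-S$ contains no path from a vertex of $X$ to a vertex of $Y$ ($X$, $Y$, $S$ may intersect). For such $S$, $V_{X,S}$ denotes the set of vertices of $G-S$ reachable in $G-S$ from $X\setminus S$, and $V_{S,Y}$ those reachable from $Y\setminus S$. A separator is minimal if no proper subset is an $(X,Y)^G$-separator. Write $S\preceq S'$ if $V_{X,S}\subseteq V_{X,S'}$. An $(X,Y,\leq k)^G$-separator is an $(X,Y)^G$-separator of size at most $k$. $S$ is a leftmost $(X,Y,\leq k)^G$-separator if it is a minimal $(X,Y,\leq k)^G$-separator and no other minimal $(X,Y,\leq k)^G$-separator $S'\neq S$ satisfies $S'\preceq S$. $S'$ dominates $S$ if $|S'|\leq|S|$ and $V_{S,Y}\subsetneq V_{S',Y}$. $S$ is an important $(X,Y,\leq k)^G$-separator if it is a minimal $(X,Y,\leq k)^G$-separator and no other minimal $(X,Y,\leq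 k)^G$-separator dominates $S$. *)

theory Defs
  imports Complex_Main "Graph_Theory.Graph_Theory"
begin

text \<open>
  Graphs are finite, simple and undirected: the locale \<open>graph\<close> of the library, where an
  undirected edge is a pair of opposite arcs.
\<close>

definition catalan :: "nat \<Rightarrow> real" where
  "catalan n = 1 / (real n + 1) * real ((2 * n) choose n)"

definition del_verts :: "('a, 'b) pre_digraph \<Rightarrow> 'a set \<Rightarrow> ('a, 'b) pre_digraph" where
  "del_verts G S = G \<restriction> (verts G - S)"

text \<open>
  A path may consist of a single vertex, so a separator contains \<open>X \<inter> Y\<close>.
\<close>

definition separator :: "('a, 'b) pre_digraph \<Rightarrow> 'a set \<Rightarrow> 'a set \<Rightarrow> 'a set \<Rightarrow> bool" where
  "separator G X Y S \<longleftrightarrow> S \<subseteq> verts G \<and>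
     \<not> (\<exists>x\<in>X. \<exists>y\<in>Y. \<exists>p. pre_digraph.apath (del_verts G S) x p y)"

text \<open>
  \<open>reach_avoiding G X S\<close> is $V_{X,S}$. Since the graph is undirected, $V_{S,Y}$ is
  \<open>reach_avoiding G Y S\<close>.
\<close>

definition reach_avoiding :: "('a, 'b) pre_digraph \<Rightarrow> 'a set \<Rightarrow> 'a set \<Rightarrow> 'a set" where
  "reach_avoiding G X S =
     {v \<in> verts (del_verts G S). \<exists>x \<in> X - S. x \<rightarrow>\<^sup>*\<^bsub>del_verts G S\<^esub> v}"

definition minimal_separator :: "('a, 'b) pre_digraph \<Rightarrow> 'a set \<Rightarrow> 'a set \<Rightarrow> 'a set \<Rightarrow> bool" where
  "minimal_separator G X Y S \<longleftrightarrow>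
     separator G X Y S \<and> \<not> (\<exists>T. T \<subset> S \<and> separator G X Y T)"

definition minimal_separator_le ::
  "('a, 'b) pre_digraph \<Rightarrow> 'a set \<Rightarrow> 'a set \<Rightarrow> nat \<Rightarrow> 'a set \<Rightarrow> bool" where
  "minimal_separator_le G X Y k S \<longleftrightarrow> minimal_separator G X Y S \<and> card S \<le> k"

definition sep_preceq :: "('a, 'b) pre_digraph \<Rightarrow> 'a set \<Rightarrow> 'a set \<Rightarrow> 'a set \<Rightarrow> bool" where
  "sep_preceq G X S S' \<longleftrightarrow> reach_avoiding G X S \<subseteq> reach_avoiding G X S'"

definition leftmost_separator ::
  "('a, 'b) pre_digraph \<Rightarrow> 'a set \<Rightarrow> 'a set \<Rightarrow> nat \<Rightarrow> 'a set \<Rightarrow> bool" where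
  "leftmost_separator G X Y k S \<longleftrightarrow> minimal_separator_le G X Y k S \<and>
     \<not> (\<exists>S'. S' \<noteq> S \<and> minimal_separator_le G X Y k S' \<and> sep_preceq G X S' S)"

definition sep_dominates :: "('a, 'b) pre_digraph \<Rightarrow> 'a set \<Rightarrow> 'a set \<Rightarrow> 'a set \<Rightarrow> bool" where
  "sep_dominates G Y S' S \<longleftrightarrow>
     card S' \<le> card S \<and> reach_avoiding G Y S \<subset> reach_avoiding G Y S'"

definition important_separator ::
  "('a, 'b) pre_digraph \<Rightarrow> 'a set \<Rightarrow> 'a set \<Rightarrow> nat \<Rightarrow> 'a set \<Rightarrow> bool" where
  "important_separator G X Y k S \<longleftrightarrow> minimal_separator_le G X Y k S \<and>
     \<not> (\<exists>S'. S' \<noteq> S \<and> minimal_separator_le G X Y k S' \<and> sep_dominates G Y S' S)"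

end

theory Submission
  imports Defs
begin

text \<open>
  A minimal separator \<open>S\<close> is the outer boundary of its $Y$-side $V_{S,Y}$, and moving \<open>S\<close> to the
  left enlarges this side. So leftmost separators correspond to the maximal sets avoiding \<open>X\<close> that
  are reached from \<open>Y\<close> and have a boundary of size at most \<open>k\<close>. These are counted by branching on a
  boundary vertex of the largest set of minimum boundary, which submodularity puts below all
  maximal sets; the recursion is that of the ballot numbers. An important separator is a leftmost
  separator for the bound given by its own size, hence the sum.

  The bounds are attained by the complete binary tree with \<open>Y\<close> the root and \<open>X\<close> the leaves: a
  minimal separator of size \<open>i\<close> is the outer boundary of a subtree with \<open>i - 1\<close> nodes.
\<close>

section \<open>Ballot numbers\<close>

text \<open>The number of binary forests with \<open>l\<close> trees and \<open>n\<close> inner nodes.\<close>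

fun ballot :: "nat \<Rightarrow> nat \<Rightarrow> nat" where
  "ballot 0 l = 1"
| "ballot (Suc n) 0 = 0"
| "ballot (Suc n) (Suc l) = ballot (Suc n) l + ballot n (l + 2)"

lemma ballot_Suc_closed_form:
  "int (ballot (Suc n) l) = int ((2 * n + l + 1) choose (Suc n)) - int ((2 * n + l + 1) choose n)"
proof (induction "Suc n" l arbitrary: n rule: ballot.induct)
  case (2 n)
  have "(2 * n + 1) choose (Suc n) = (2 * n + 1) choose n"
    by (subst binomial_symmetric) auto
  then show ?case
    by simp
next
  case (3 n l)
  show ?case
  proof (cases n)
    case 0
    then show ?thesis
      using 3(1) by simp
  next
    case (Suc m)
    have "int (ballot n (l + 2)) =
        int ((2 * m + (l + 2) + 1) choose (Suc m)) - int ((2 * m + (l + 2) + 1) choose m)"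
      using 3(2)[OF Suc] Suc by simp
    then show ?thesis
      using 3(1) Suc by simp
  qed
qed

lemma ballot_1_eq_catalan: "real (ballot n 1) = catalan n"
proof (cases n)
  case 0
  then show ?thesis
    by (simp add: catalan_def)
next
  case (Suc m)
  let ?c = "real ((2 * n) choose n)" and ?d = "real ((2 * n) choose m)"
  have "int (ballot n 1) = int ((2 * n) choose n) - int ((2 * n) choose m)"
    using ballot_Suc_closed_form[of m 1] Suc by simp
  then have "real (ballot n 1) = ?c - ?d"
    by linarith
  moreover have "Suc m * ((2 * n) choose Suc m) = (2 * n - m) * ((2 * n) choose m)"
    using binomial_absorb_comp[of "2 * n" m] binomial_absorption[of m "2 * n"] by simp
  then have "real n * ?c = (real n + 1) * ?d"
    unfolding Suc by (simp flip: of_nat_mult add: algebra_simps)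
  then have "(real n + 1) * (?c - ?d) = ?c"
    by (simp add: algebra_simps)
  ultimately have "(real n + 1) * real (ballot n 1) = ?c"
    by simp
  then show ?thesis
    unfolding catalan_def by (simp add: field_simps del: One_nat_def)
qed

lemma ballot_pos: "0 < l \<Longrightarrow> 0 < ballot n l"
  by (induction n l rule: ballot.induct) auto

section \<open>Accessible sets\<close>

text \<open>
  In a graph, \<open>F D\<close> consists of the starting vertices and the neighbours of \<open>D\<close>. Keeping \<open>F\<close>
  abstract makes deleting a vertex \<open>v\<close> the passage to \<open>\<lambda>D. F D - {v}\<close>.
\<close>

definition boundary :: "('a set \<Rightarrow> 'a set) \<Rightarrow> 'a set \<Rightarrow> 'a set" where
  "boundary F C = F C - C"

definition accessible_part :: "('a set \<Rightarrow> 'a set) \<Rightarrow> 'a set \<Rightarrow> 'a set \<Rightarrow> 'a set" where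
  "accessible_part F B C = lfp (\<lambda>D. B \<union> F D \<inter> C)"

definition accessible :: "('a set \<Rightarrow> 'a set) \<Rightarrow> 'a set \<Rightarrow> 'a set \<Rightarrow> bool" where
  "accessible F B C \<longleftrightarrow> accessible_part F B C = C"

lemma accessible_part_unfold:
  assumes "mono F"
  shows "accessible_part F B C = B \<union> F (accessible_part F B C) \<inter> C"
proof -
  have "mono (\<lambda>D. B \<union> F D \<inter> C)"
    using monoD[OF assms] by (intro monoI) blast
  then show ?thesis
    unfolding accessible_part_def by (rule lfp_unfold)
qed

lemma accessible_part_least:
  "\<lbrakk>B \<subseteq> D; F D \<inter> C \<subseteq> D\<rbrakk> \<Longrightarrow> accessible_part F B C \<subseteq> D"
  unfolding accessible_part_def by (rule lfp_lowerbound) blast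

lemma accessible_part_mono: "C \<subseteq> D \<Longrightarrow> accessible_part F B C \<subseteq> accessible_part F B D"
  unfolding accessible_part_def by (rule lfp_mono) blast

lemma base_subset_accessible_part: "B \<subseteq> accessible_part F B C"
  unfolding accessible_part_def by (rule lfp_greatest) blast

lemma accessible_part_closed: "mono F \<Longrightarrow> F (accessible_part F B C) \<inter> C \<subseteq> accessible_part F B C"
  using equalityD2[OF accessible_part_unfold] by blast

lemma accessible_part_subset: "B \<subseteq> C \<Longrightarrow> accessible_part F B C \<subseteq> C"
  by (rule accessible_part_least) simp_all

lemma accessibleI: "\<lbrakk>B \<subseteq> C; C \<subseteq> accessible_part F B C\<rbrakk> \<Longrightarrow> accessible F B C"
  unfolding accessible_def by (intro equalityI accessible_part_subset)

lemma accessible_refl: "accessible F B B"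
  by (intro accessibleI base_subset_accessible_part subset_refl)

lemma accessible_supset_base: "accessible F B C \<Longrightarrow> B \<subseteq> C"
  unfolding accessible_def using base_subset_accessible_part[of B F C] by simp

lemma accessible_subset_step: "\<lbrakk>mono F; accessible F B C\<rbrakk> \<Longrightarrow> C \<subseteq> B \<union> F C"
  unfolding accessible_def using equalityD1[OF accessible_part_unfold[of F B C]] by auto

lemma accessible_subset_closed:
  "\<lbrakk>accessible F B C; B \<subseteq> D; F D \<inter> C \<subseteq> D\<rbrakk> \<Longrightarrow> C \<subseteq> D"
  unfolding accessible_def using accessible_part_least[of B D F C] by simp

lemma accessible_subset_if_disjoint_boundary:
  "\<lbrakk>accessible F B C; B \<subseteq> D; C \<inter> boundary F D = {}\<rbrakk> \<Longrightarrow> C \<subseteq> D"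
  using accessible_subset_closed[of F B C D] unfolding boundary_def by blast

lemma accessible_subset_accessible_part:
  "\<lbrakk>accessible F B C; C \<subseteq> D\<rbrakk> \<Longrightarrow> C \<subseteq> accessible_part F B D"
  unfolding accessible_def using accessible_part_mono[of C D F B] by simp

lemma accessible_accessible_part:
  assumes "mono F" "B \<subseteq> C"
  shows "accessible F B (accessible_part F B C)"
proof (rule accessibleI)
  let ?P = "accessible_part F B C"
  let ?Q = "accessible_part F B ?P"
  show B: "B \<subseteq> ?P"
    by (rule base_subset_accessible_part)
  have "F ?Q \<inter> C \<subseteq> F ?P \<inter> C"
    using monoD[OF assms(1) accessible_part_subset[OF B]] by blast
  also have "\<dots> \<subseteq> ?P"
    using assms(1) by (rule accessible_part_closed)
  finally have "F ?Q \<inter> C \<subseteq> ?Q"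
    using accessible_part_closed[OF assms(1), of B ?P] by blast
  then show "?P \<subseteq> ?Q"
    using base_subset_accessible_part by (intro accessible_part_least)
qed

lemma boundary_accessible_part_subset:
  assumes "mono F" "B \<subseteq> C"
  shows "boundary F (accessible_part F B C) \<subseteq> boundary F C"
  using monoD[OF assms(1) accessible_part_subset[OF assms(2)]] accessible_part_closed[OF assms(1)]
  unfolding boundary_def by blast

lemma accessible_part_minus_boundary:
  assumes "accessible F B C" "C \<subseteq> V"
  shows "accessible_part F B (V - boundary F C) = C"
proof
  show "accessible_part F B (V - boundary F C) \<subseteq> C"
    using accessible_supset_base[OF assms(1)]
    by (rule accessible_part_least) (auto simp: boundary_def)
  show "C \<subseteq> accessible_part F B (V - boundary F C)"
    using assms by (intro accessible_subset_accessible_part) (auto simp: boundary_def)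
qed

lemma accessible_Un:
  assumes "accessible F B C" "accessible F B D"
  shows "accessible F B (C \<union> D)"
proof (rule accessibleI)
  show "B \<subseteq> C \<union> D"
    using accessible_supset_base[OF assms(1)] by blast
  show "C \<union> D \<subseteq> accessible_part F B (C \<union> D)"
    using assms by (intro Un_least accessible_subset_accessible_part) simp_all
qed

lemma accessible_trans:
  assumes "mono F" "accessible F B L" "accessible F L C"
  shows "accessible F B C"
proof (rule accessibleI)
  have LC: "L \<subseteq> C"
    using assms(3) by (rule accessible_supset_base)
  then show "B \<subseteq> C"
    using accessible_supset_base[OF assms(2)] by blast
  show "C \<subseteq> accessible_part F B C"
    using assms(3) accessible_subset_accessible_part[OF assms(2) LC]
      accessible_part_closed[OF assms(1)] by (rule accessible_subset_closed)
qed

lemma accessible_larger_base: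
  assumes "mono F" "accessible F B C" "B \<subseteq> L" "L \<subseteq> C"
  shows "accessible F L C"
proof (rule accessibleI[OF assms(4)])
  have "B \<subseteq> accessible_part F L C"
    using assms(3) base_subset_accessible_part[of L F C] by blast
  then show "C \<subseteq> accessible_part F L C"
    using accessible_part_closed[OF assms(1)] by (rule accessible_subset_closed[OF assms(2)])
qed

lemma accessible_insert:
  assumes "mono F" "accessible F B C" "v \<in> F C"
  shows "accessible F B (insert v C)"
proof (rule accessibleI)
  show "B \<subseteq> insert v C"
    using accessible_supset_base[OF assms(2)] by blast
  let ?P = "accessible_part F B (insert v C)"
  have "C \<subseteq> ?P"
    using assms(2) by (rule accessible_subset_accessible_part) blast
  moreover from this have "v \<in> ?P"
    using assms(3) monoD[OF assms(1)] accessible_part_closed[OF assms(1), of B "insert v C"]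
    by blast
  ultimately show "insert v C \<subseteq> ?P"
    by blast
qed

lemma accessible_mono_step:
  assumes "mono F'" "accessible F B C" "\<And>D. D \<subseteq> C \<Longrightarrow> F D \<inter> C \<subseteq> F' D"
  shows "accessible F' B C"
proof (rule accessibleI)
  show "B \<subseteq> C"
    using assms(2) by (rule accessible_supset_base)
  let ?P = "accessible_part F' B C"
  have "F ?P \<inter> C \<subseteq> F' ?P \<inter> C"
    using assms(3)[OF accessible_part_subset[OF \<open>B \<subseteq> C\<close>]] by blast
  also have "\<dots> \<subseteq> ?P"
    using assms(1) by (rule accessible_part_closed)
  finally show "C \<subseteq> ?P"
    using base_subset_accessible_part by (intro accessible_subset_closed[OF assms(2)])
qed

section \<open>Maximal sets of bounded boundary\<close>

definition bounded_sets ::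
  "('a set \<Rightarrow> 'a set) \<Rightarrow> 'a set \<Rightarrow> 'a set \<Rightarrow> nat \<Rightarrow> 'a set set" where
  "bounded_sets F B U k = {C. C \<subseteq> U \<and> accessible F B C \<and> card (boundary F C) \<le> k}"

definition maximal_bounded_sets ::
  "('a set \<Rightarrow> 'a set) \<Rightarrow> 'a set \<Rightarrow> 'a set \<Rightarrow> nat \<Rightarrow> 'a set set" where
  "maximal_bounded_sets F B U k =
     {C \<in> bounded_sets F B U k. \<forall>D \<in> bounded_sets F B U k. C \<subseteq> D \<longrightarrow> D = C}"

definition boundaries_ge ::
  "('a set \<Rightarrow> 'a set) \<Rightarrow> 'a set \<Rightarrow> 'a set \<Rightarrow> nat \<Rightarrow> bool" where
  "boundaries_ge F B U l \<longleftrightarrow> (\<forall>C. B \<subseteq> C \<and> C \<subseteq> U \<longrightarrow> l \<le> card (boundary F C))"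

lemma bounded_setsD:
  assumes "C \<in> bounded_sets F B U k"
  shows "C \<subseteq> U" "accessible F B C" "card (boundary F C) \<le> k"
  using assms unfolding bounded_sets_def by simp_all

lemma boundaries_geD:
  "\<lbrakk>boundaries_ge F B U l; B \<subseteq> C; C \<subseteq> U\<rbrakk> \<Longrightarrow> l \<le> card (boundary F C)"
  unfolding boundaries_ge_def by blast

lemma boundaries_ge_larger_base: "\<lbrakk>boundaries_ge F B U l; B \<subseteq> L\<rbrakk> \<Longrightarrow> boundaries_ge F L U l"
  unfolding boundaries_ge_def by blast

lemma finite_bounded_sets: "finite U \<Longrightarrow> finite (bounded_sets F B U k)"
  by (rule finite_subset[of _ "Pow U"]) (auto dest: bounded_setsD)

lemma maximal_bounded_setsD:
  assumes "C \<in> maximal_bounded_sets F B U k"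
  shows "C \<in> bounded_sets F B U k" "\<And>D. \<lbrakk>D \<in> bounded_sets F B U k; C \<subseteq> D\<rbrakk> \<Longrightarrow> D = C"
  using assms unfolding maximal_bounded_sets_def by blast+

lemma maximal_bounded_setsI:
  "\<lbrakk>C \<in> bounded_sets F B U k; \<And>D. \<lbrakk>D \<in> bounded_sets F B U k; C \<subseteq> D\<rbrakk> \<Longrightarrow> D = C\<rbrakk>
    \<Longrightarrow> C \<in> maximal_bounded_sets F B U k"
  unfolding maximal_bounded_sets_def by blast

lemma finite_maximal_bounded_sets: "finite U \<Longrightarrow> finite (maximal_bounded_sets F B U k)"
  unfolding maximal_bounded_sets_def by (simp add: finite_bounded_sets)

lemma maximal_bounded_sets_nonempty:
  assumes "finite U" "bounded_sets F B U k \<noteq> {}"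
  shows "maximal_bounded_sets F B U k \<noteq> {}"
  using finite_has_maximal[OF finite_bounded_sets[OF assms(1)] assms(2)]
  unfolding maximal_bounded_sets_def by blast

lemma bounded_sets_accessible_base:
  assumes "mono F" "accessible F B L"
  shows "bounded_sets F L U k = {C \<in> bounded_sets F B U k. L \<subseteq> C}"
proof -
  have "accessible F L C \<longleftrightarrow> accessible F B C \<and> L \<subseteq> C" for C
    using accessible_trans[OF assms] accessible_larger_base[OF assms(1) _ accessible_supset_base]
      accessible_supset_base[of F L C] assms(2) by blast
  then show ?thesis
    unfolding bounded_sets_def by blast
qed

lemma maximal_bounded_sets_accessible_base:
  assumes "mono F" "accessible F B L"
  shows "maximal_bounded_sets F L U k = {C \<in> maximal_bounded_sets F B U k. L \<subseteq> C}"
  unfolding maximal_bounded_sets_def bounded_sets_accessible_base[OF assms] by blast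

lemma maximal_bounded_sets_insert:
  assumes "mono F" "v \<in> boundary F L"
  shows "maximal_bounded_sets F (insert v L) U k = {C \<in> maximal_bounded_sets F L U k. v \<in> C}"
proof -
  have "accessible F L (insert v L)"
    using assms by (intro accessible_insert accessible_refl) (simp_all add: boundary_def)
  moreover have "L \<subseteq> C" if "C \<in> maximal_bounded_sets F L U k" for C
    using that by (intro accessible_supset_base bounded_setsD(2) maximal_bounded_setsD(1))
  ultimately show ?thesis
    using maximal_bounded_sets_accessible_base[OF assms(1)] by blast
qed

lemma boundary_delete: "boundary (\<lambda>C. F C - {v}) C = boundary F C - {v}"
  unfolding boundary_def by blast

lemma accessible_delete:
  assumes "v \<notin> C"
  shows "accessible (\<lambda>C. F C - {v}) B C \<longleftrightarrow> accessible F B C"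
proof -
  have "(F D - {v}) \<inter> C = F D \<inter> C" for D
    using assms by blast
  then show ?thesis
    unfolding accessible_def accessible_part_def by simp
qed

lemma boundaries_ge_delete:
  assumes "boundaries_ge F B U (Suc l)"
  shows "boundaries_ge (\<lambda>C. F C - {v}) B (U - {v}) l"
  unfolding boundaries_ge_def boundary_delete
proof (intro allI impI)
  fix C assume "B \<subseteq> C \<and> C \<subseteq> U - {v}"
  then have "Suc l \<le> card (boundary F C)"
    by (intro boundaries_geD[OF assms]) auto
  then show "l \<le> card (boundary F C - {v})"
    using diff_card_le_card_Diff[of "{v}" "boundary F C"] by simp
qed

locale finite_expansion =
  fixes F :: "'a set \<Rightarrow> 'a set" and U :: "'a set"
  assumes F_Un: "F (C \<union> D) = F C \<union> F D"
    and finite_U: "finite U" and finite_F_U: "finite (F U)"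
begin

lemma mono_F: "mono F"
proof
  fix C D :: "'a set" assume "C \<subseteq> D"
  then show "F C \<subseteq> F D"
    using F_Un[of C D] by (simp add: Un_absorb1 sup.absorb_iff2)
qed

lemma finite_expansion_delete: "finite_expansion (\<lambda>C. F C - {v}) (U - {v})"
proof
  show "finite (F (U - {v}) - {v})"
    using monoD[OF mono_F, of "U - {v}" U] finite_F_U by (blast intro: finite_subset)
qed (auto simp: F_Un finite_U)

lemma finite_boundary: "C \<subseteq> U \<Longrightarrow> finite (boundary F C)"
  unfolding boundary_def using monoD[OF mono_F, of C U] finite_subset[OF _ finite_F_U] by simp

lemma card_boundary_submodular:
  assumes "C \<subseteq> U" "D \<subseteq> U"
  shows "card (boundary F (C \<inter> D)) + card (boundary F (C \<union> D))
    \<le> card (boundary F C) + card (boundary F D)"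
proof -
  let ?b = "boundary F"
  have "F (C \<inter> D) \<subseteq> F C \<inter> F D"
    using monoD[OF mono_F] by simp
  then have un: "?b (C \<inter> D) \<union> ?b (C \<union> D) \<subseteq> ?b C \<union> ?b D"
    and int: "?b (C \<inter> D) \<inter> ?b (C \<union> D) \<subseteq> ?b C \<inter> ?b D"
    unfolding boundary_def F_Un by blast+
  have fin: "finite (?b C)" "finite (?b D)" "finite (?b (C \<inter> D))" "finite (?b (C \<union> D))"
    using assms by (auto intro: finite_boundary)
  have "card (?b (C \<inter> D)) + card (?b (C \<union> D))
      = card (?b (C \<inter> D) \<union> ?b (C \<union> D)) + card (?b (C \<inter> D) \<inter> ?b (C \<union> D))"
    using fin(3,4) by (rule card_Un_Int)
  also have "\<dots> \<le> card (?b C \<union> ?b D) + card (?b C \<inter> ?b D)"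
    using fin by (intro add_mono card_mono un int) auto
  also have "\<dots> = card (?b C) + card (?b D)"
    using fin(1,2) by (rule card_Un_Int[symmetric])
  finally show ?thesis .
qed

lemma bounded_sets_Un:
  assumes "boundaries_ge F B U l" "C \<in> bounded_sets F B U k" "L \<in> bounded_sets F B U l"
  shows "C \<union> L \<in> bounded_sets F B U k"
proof -
  note C = bounded_setsD[OF assms(2)] and L = bounded_setsD[OF assms(3)]
  have "l \<le> card (boundary F (C \<inter> L))"
    using accessible_supset_base[OF C(2)] accessible_supset_base[OF L(2)] C(1)
    by (intro boundaries_geD[OF assms(1)]) auto
  then have "card (boundary F (C \<union> L)) \<le> k"
    using card_boundary_submodular[OF C(1) L(1)] C(3) L(3) by linarith
  then show ?thesis
    using C L accessible_Un unfolding bounded_sets_def by blast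
qed

lemma maximal_bounded_sets_supset:
  assumes "boundaries_ge F B U l" "C \<in> maximal_bounded_sets F B U k" "L \<in> bounded_sets F B U l"
  shows "L \<subseteq> C"
  using maximal_bounded_setsD(2)[OF assms(2)] assms(3)
    bounded_sets_Un[OF assms(1) maximal_bounded_setsD(1)[OF assms(2)]] by blast

lemma card_maximal_bounded_sets_le_1:
  assumes "boundaries_ge F B U l"
  shows "card (maximal_bounded_sets F B U l) \<le> 1"
proof -
  have "C = D" if "C \<in> maximal_bounded_sets F B U l" "D \<in> maximal_bounded_sets F B U l" for C D
    using that maximal_bounded_sets_supset[OF assms] maximal_bounded_setsD(1) by blast
  then show ?thesis
    using card_le_Suc0_iff_eq[OF finite_maximal_bounded_sets[OF finite_U]] by auto
qed

lemma accessible_part_mem_bounded_sets: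
  assumes "B \<subseteq> C" "C \<subseteq> U" "card (boundary F C) \<le> k"
  shows "accessible_part F B C \<in> bounded_sets F B U k"
proof -
  have "card (boundary F (accessible_part F B C)) \<le> card (boundary F C)"
    using finite_boundary[OF assms(2)] boundary_accessible_part_subset[OF mono_F assms(1)]
    by (rule card_mono)
  then have "card (boundary F (accessible_part F B C)) \<le> k"
    using assms(3) by simp
  moreover have "accessible_part F B C \<subseteq> U"
    using accessible_part_subset[OF assms(1)] assms(2) by blast
  ultimately show ?thesis
    using accessible_accessible_part[OF mono_F assms(1)] unfolding bounded_sets_def by simp
qed

lemma boundaries_ge_insert:
  assumes L: "L \<in> bounded_sets F B U l" and greatest: "\<And>D. D \<in> bounded_sets F B U l \<Longrightarrow> D \<subseteq> L"
    and v: "v \<in> boundary F L"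
  shows "boundaries_ge F (insert v L) U (Suc l)"
  unfolding boundaries_ge_def
proof (intro allI impI, rule ccontr)
  fix C assume C: "insert v L \<subseteq> C \<and> C \<subseteq> U" and "\<not> Suc l \<le> card (boundary F C)"
  let ?D = "accessible_part F B C"
  have "accessible F B L"
    using L by (rule bounded_setsD)
  then have "B \<subseteq> L"
    by (rule accessible_supset_base)
  moreover have "L \<subseteq> ?D"
    using \<open>accessible F B L\<close> C by (intro accessible_subset_accessible_part) auto
  moreover have "?D \<subseteq> L"
    using C \<open>B \<subseteq> L\<close> \<open>\<not> Suc l \<le> card (boundary F C)\<close>
    by (intro greatest accessible_part_mem_bounded_sets) auto
  ultimately have "F L \<inter> C \<subseteq> L"
    using accessible_part_closed[OF mono_F, of B C] by simp
  then show False
    using v C unfolding boundary_def by blast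
qed

lemma obtain_greatest_of_minimum_boundary:
  assumes ge: "boundaries_ge F B U l" and not_ge: "\<not> boundaries_ge F B U (Suc l)"
  obtains L where "B \<subseteq> L" "card (boundary F L) = l"
    "\<forall>k. maximal_bounded_sets F B U k = maximal_bounded_sets F L U k"
    "\<forall>v\<in>boundary F L. boundaries_ge F (insert v L) U (Suc l)"
proof -
  obtain C where "B \<subseteq> C" "C \<subseteq> U" "card (boundary F C) \<le> l"
    using not_ge unfolding boundaries_ge_def Suc_le_eq by (auto simp: not_less)
  then have "bounded_sets F B U l \<noteq> {}"
    using accessible_part_mem_bounded_sets by blast
  then obtain L where L_max: "L \<in> maximal_bounded_sets F B U l"
    using maximal_bounded_sets_nonempty[OF finite_U] by blast
  then have L: "L \<in> bounded_sets F B U l"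
    by (rule maximal_bounded_setsD)
  note L_bounded = bounded_setsD[OF L]
  show ?thesis
  proof (rule that)
    show "B \<subseteq> L"
      using L_bounded(2) by (rule accessible_supset_base)
    show "card (boundary F L) = l"
      using L_bounded(3) boundaries_geD[OF ge \<open>B \<subseteq> L\<close> L_bounded(1)] by (rule le_antisym)
    show "\<forall>k. maximal_bounded_sets F B U k = maximal_bounded_sets F L U k"
      using maximal_bounded_sets_accessible_base[OF mono_F L_bounded(2)]
        maximal_bounded_sets_supset[OF ge _ L] by blast
    show "\<forall>v\<in>boundary F L. boundaries_ge F (insert v L) U (Suc l)"
      using L maximal_bounded_sets_supset[OF ge L_max] by (intro ballI boundaries_ge_insert)
  qed
qed

lemma bounded_sets_delete:
  assumes "v \<in> boundary F L"
  shows "bounded_sets (\<lambda>C. F C - {v}) L (U - {v}) k = {C \<in> bounded_sets F L U (Suc k). v \<notin> C}"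
proof (intro set_eqI)
  fix C
  show "C \<in> bounded_sets (\<lambda>C. F C - {v}) L (U - {v}) k \<longleftrightarrow>
      C \<in> {C \<in> bounded_sets F L U (Suc k). v \<notin> C}"
  proof (cases "v \<notin> C \<and> C \<subseteq> U \<and> L \<subseteq> C")
    case True
    then have "v \<in> boundary F C"
      using assms monoD[OF mono_F, of L C] unfolding boundary_def by blast
    then have "card (boundary F C) = Suc (card (boundary F C - {v}))"
      using True by (intro card.remove finite_boundary) auto
    then show ?thesis
      using True by (auto simp: bounded_sets_def boundary_delete accessible_delete)
  next
    case False
    then show ?thesis
      using accessible_supset_base[of _ L C] unfolding bounded_sets_def by blast
  qed
qed

lemma card_maximal_bounded_sets_le_delete_plus_insert:
  assumes "v \<in> boundary F L"
  shows "card (maximal_bounded_sets F L U (Suc k))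
    \<le> card (maximal_bounded_sets (\<lambda>C. F C - {v}) L (U - {v}) k) +
      card (maximal_bounded_sets F (insert v L) U (Suc k))"
    (is "card ?all \<le> card ?deleted + card ?inserted")
proof -
  have "C \<in> ?deleted" if "C \<in> ?all" "v \<notin> C" for C
    using that unfolding maximal_bounded_sets_def bounded_sets_delete[OF assms] by blast
  then have "?all \<subseteq> ?deleted \<union> ?inserted"
    unfolding maximal_bounded_sets_insert[OF mono_F assms] by blast
  then have "card ?all \<le> card (?deleted \<union> ?inserted)"
    using finite_U by (intro card_mono) (auto intro!: finite_maximal_bounded_sets)
  also have "\<dots> \<le> card ?deleted + card ?inserted"
    by (rule card_Un_le)
  finally show ?thesis .
qed

lemma card_maximal_bounded_sets_le_max_insert:
  assumes "boundary F L = {v}"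
  shows "card (maximal_bounded_sets F L U k)
    \<le> max 1 (card (maximal_bounded_sets F (insert v L) U k))"
    (is "card ?all \<le> max 1 (card ?inserted)")
proof -
  have L: "L \<subseteq> C" "accessible F L C" if "C \<in> ?all" for C
    using that
    by (intro accessible_supset_base bounded_setsD(2) maximal_bounded_setsD(1); assumption)+
  have C_eq_L: "C = L" if "C \<in> ?all" "v \<notin> C" for C
  proof
    show "C \<subseteq> L"
      using L(2)[OF that(1)] subset_refl
      by (rule accessible_subset_if_disjoint_boundary) (use assms that(2) in simp)
  qed (rule L(1)[OF that(1)])
  show ?thesis
  proof (cases "L \<in> ?all")
    case True
    then have "?all \<subseteq> {L}"
      using L(1) maximal_bounded_setsD(2)[OF True] maximal_bounded_setsD(1)[of _ F L U k] by blast
    then have "card ?all \<le> card {L}"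
      by (intro card_mono) simp_all
    then show ?thesis
      by simp
  next
    case False
    then have "?all \<subseteq> ?inserted"
      using C_eq_L maximal_bounded_sets_insert[OF mono_F, of v L] assms by blast
    then have "card ?all \<le> card ?inserted"
      by (intro card_mono finite_maximal_bounded_sets finite_U)
    then show ?thesis
      by simp
  qed
qed

lemma obtain_branching:
  assumes ge: "boundaries_ge F B U (Suc l)" and "\<not> boundaries_ge F B U (Suc (Suc l))"
  obtains L v where "boundaries_ge (\<lambda>C. F C - {v}) L (U - {v}) l"
    "boundaries_ge F (insert v L) U (Suc (Suc l))"
    "card (maximal_bounded_sets F B U (Suc k))
      \<le> card (maximal_bounded_sets (\<lambda>C. F C - {v}) L (U - {v}) k) +
        card (maximal_bounded_sets F (insert v L) U (Suc k))"
    "l = 0 \<longrightarrow> card (maximal_bounded_sets F B U (Suc k))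
      \<le> max 1 (card (maximal_bounded_sets F (insert v L) U (Suc k)))"
proof -
  obtain L where "B \<subseteq> L" and card_L: "card (boundary F L) = Suc l"
    and "\<forall>k. maximal_bounded_sets F B U k = maximal_bounded_sets F L U k"
    and ge_insert: "\<forall>v\<in>boundary F L. boundaries_ge F (insert v L) U (Suc (Suc l))"
    using assms by (rule obtain_greatest_of_minimum_boundary)
  then have same_maximal: "maximal_bounded_sets F B U (Suc k) = maximal_bounded_sets F L U (Suc k)"
    by blast
  obtain v where v: "v \<in> boundary F L"
    using card_L by fastforce
  show ?thesis
  proof (rule that)
    show "boundaries_ge (\<lambda>C. F C - {v}) L (U - {v}) l"
      by (rule boundaries_ge_delete[OF boundaries_ge_larger_base[OF ge \<open>B \<subseteq> L\<close>]])
    show "boundaries_ge F (insert v L) U (Suc (Suc l))"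
      using ge_insert v by (rule bspec)
    show "card (maximal_bounded_sets F B U (Suc k))
      \<le> card (maximal_bounded_sets (\<lambda>C. F C - {v}) L (U - {v}) k) +
        card (maximal_bounded_sets F (insert v L) U (Suc k))"
      unfolding same_maximal using v by (rule card_maximal_bounded_sets_le_delete_plus_insert)
    show "l = 0 \<longrightarrow> card (maximal_bounded_sets F B U (Suc k))
      \<le> max 1 (card (maximal_bounded_sets F (insert v L) U (Suc k)))"
    proof
      assume "l = 0"
      then have "boundary F L = {v}"
        using card_L v by (auto simp: card_Suc_eq)
      then show "card (maximal_bounded_sets F B U (Suc k))
          \<le> max 1 (card (maximal_bounded_sets F (insert v L) U (Suc k)))"
        unfolding same_maximal by (rule card_maximal_bounded_sets_le_max_insert)
    qed
  qed
qed

end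

text \<open>
  If the minimum boundary is a single vertex \<open>v\<close>, deleting \<open>v\<close> yields a maximal set only when
  there is no other one; this is what makes the bound a single Catalan number instead of a sum.
\<close>

theorem card_maximal_bounded_sets_le_ballot:
  assumes "finite_expansion F U" "boundaries_ge F B U l" "0 < l"
  shows "card (maximal_bounded_sets F B U (n + l)) \<le> ballot n l"
  using assms
proof (induction n l arbitrary: F B U rule: ballot.induct)
  case (1 l)
  then show ?case
    using finite_expansion.card_maximal_bounded_sets_le_1 by fastforce
next
  case (2 n)
  then show ?case by simp
next
  case (3 n l)
  interpret finite_expansion F U
    by (rule "3.prems"(1))
  let ?k = "Suc n + l"
  have larger_minimum: "card (maximal_bounded_sets F C U (Suc ?k)) \<le> ballot n (l + 2)"
    if "boundaries_ge F C U (Suc (Suc l))" for C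
    using "3.IH"(2)[OF "3.prems"(1), of C] that by simp
  show ?case
  proof (cases "boundaries_ge F B U (Suc (Suc l))")
    case True
    then show ?thesis
      using larger_minimum by (simp add: trans_le_add2)
  next
    case False
    obtain L v where delete: "boundaries_ge (\<lambda>C. F C - {v}) L (U - {v}) l"
      and insert: "boundaries_ge F (insert v L) U (Suc (Suc l))"
      and branch: "card (maximal_bounded_sets F B U (Suc ?k))
        \<le> card (maximal_bounded_sets (\<lambda>C. F C - {v}) L (U - {v}) ?k) +
          card (maximal_bounded_sets F (insert v L) U (Suc ?k))"
      and branch_0: "l = 0 \<longrightarrow> card (maximal_bounded_sets F B U (Suc ?k))
        \<le> max 1 (card (maximal_bounded_sets F (insert v L) U (Suc ?k)))"
      using "3.prems"(2) False by (rule obtain_branching[where k = ?k])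
    show ?thesis
    proof (cases "l = 0")
      case True
      then show ?thesis
        using branch_0 larger_minimum[OF insert] ballot_pos[of "l + 2" n] by simp
    next
      case False
      have "card (maximal_bounded_sets (\<lambda>C. F C - {v}) L (U - {v}) ?k) \<le> ballot (Suc n) l"
        using False by (intro "3.IH"(1) finite_expansion_delete delete) simp
      then show ?thesis
        using branch larger_minimum[OF insert] by simp
    qed
  qed
qed

section \<open>Separators as boundaries\<close>

definition reach_step :: "('a, 'b) pre_digraph \<Rightarrow> 'a set \<Rightarrow> 'a set \<Rightarrow> 'a set" where
  "reach_step G Y C = Y \<union> arcs_ends G `` C"

lemma mono_reach_step: "mono (reach_step G Y)"
  unfolding reach_step_def by (intro monoI) blast

lemma verts_del_verts: "verts (del_verts G S) = verts G - S"
  unfolding del_verts_def by simp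

context wf_digraph
begin

lemma dominates_del_verts_iff:
  "u \<rightarrow>\<^bsub>del_verts G S\<^esub> v \<longleftrightarrow> u \<rightarrow>\<^bsub>G\<^esub> v \<and> u \<notin> S \<and> v \<notin> S"
  unfolding del_verts_def arcs_ends_conv by (auto simp: image_iff)

lemma wf_digraph_del_verts: "wf_digraph (del_verts G S)"
  unfolding del_verts_def by (rule wellformed_induce_subgraph)

lemma reach_step_subset_verts: "Y \<subseteq> verts G \<Longrightarrow> reach_step G Y C \<subseteq> verts G"
  unfolding reach_step_def using adj_in_verts by blast

lemma reach_avoiding_closed:
  assumes "Y \<subseteq> verts G"
  shows "reach_step G Y (reach_avoiding G Y S) \<inter> (verts G - S) \<subseteq> reach_avoiding G Y S"
proof
  interpret H: wf_digraph "del_verts G S"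
    by (rule wf_digraph_del_verts)
  fix w assume w: "w \<in> reach_step G Y (reach_avoiding G Y S) \<inter> (verts G - S)"
  then consider "w \<in> Y" | u where "u \<in> reach_avoiding G Y S" "u \<rightarrow>\<^bsub>G\<^esub> w"
    by (auto simp: reach_step_def)
  then show "w \<in> reach_avoiding G Y S"
  proof cases
    case 1
    moreover from w have "w \<rightarrow>\<^sup>*\<^bsub>del_verts G S\<^esub> w"
      by (simp add: H.reachable_refl verts_del_verts)
    ultimately show ?thesis
      using w unfolding reach_avoiding_def verts_del_verts by blast
  next
    case 2
    then obtain y where y: "y \<in> Y - S" "y \<rightarrow>\<^sup>*\<^bsub>del_verts G S\<^esub> u"
      and u_w: "u \<rightarrow>\<^bsub>del_verts G S\<^esub> w"
      using w by (auto simp: reach_avoiding_def verts_del_verts dominates_del_verts_iff)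
    from y(2) u_w have "y \<rightarrow>\<^sup>*\<^bsub>del_verts G S\<^esub> w"
      by (rule H.reachable_adj_trans)
    then show ?thesis
      using y(1) w by (auto simp: reach_avoiding_def verts_del_verts)
  qed
qed

lemma reach_avoiding_least:
  assumes closed: "reach_step G Y D \<inter> (verts G - S) \<subseteq> D"
  shows "reach_avoiding G Y S \<subseteq> D"
proof
  fix v assume "v \<in> reach_avoiding G Y S"
  then obtain y where y: "y \<in> Y - S" "y \<rightarrow>\<^sup>*\<^bsub>del_verts G S\<^esub> v"
    unfolding reach_avoiding_def by blast
  interpret H: wf_digraph "del_verts G S"
    by (rule wf_digraph_del_verts)
  from y(2) show "v \<in> D"
  proof (induction rule: H.reachable_induct)
    case base
    then have "y \<in> reach_step G Y D \<inter> (verts G - S)"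
      using y(1) by (simp add: reach_step_def verts_del_verts)
    then show ?case
      by (rule subsetD[OF closed])
  next
    case (step u w)
    then have "u \<rightarrow>\<^bsub>G\<^esub> w" "w \<notin> S"
      by (simp_all add: dominates_del_verts_iff)
    then have "w \<in> reach_step G Y D \<inter> (verts G - S)"
      using step.IH adj_in_verts(2) unfolding reach_step_def by blast
    then show ?case
      by (rule subsetD[OF closed])
  qed
qed

lemma reach_avoiding_eq_accessible_part:
  assumes "Y \<subseteq> verts G"
  shows "reach_avoiding G Y S = accessible_part (reach_step G Y) {} (verts G - S)"
proof
  show "reach_avoiding G Y S \<subseteq> accessible_part (reach_step G Y) {} (verts G - S)"
    using mono_reach_step by (intro reach_avoiding_least accessible_part_closed)
  show "accessible_part (reach_step G Y) {} (verts G - S) \<subseteq> reach_avoiding G Y S"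
    using reach_avoiding_closed[OF assms] by (intro accessible_part_least empty_subsetI)
qed

lemma separator_altdef:
  "separator G X Y S \<longleftrightarrow> S \<subseteq> verts G \<and> \<not> (\<exists>x\<in>X. \<exists>y\<in>Y. x \<rightarrow>\<^sup>*\<^bsub>del_verts G S\<^esub> y)"
  unfolding separator_def wf_digraph.reachable_apath[OF wf_digraph_del_verts] ..

end

lemma minimal_separator_eq_empty:
  "\<lbrakk>separator G X Y {}; minimal_separator G X Y S\<rbrakk> \<Longrightarrow> S = {}"
  unfolding minimal_separator_def by blast

lemma (in fin_digraph) minimal_separator_exists:
  assumes "separator G X Y S"
  shows "\<exists>T \<subseteq> S. minimal_separator G X Y T"
proof -
  let ?F = "{T. T \<subseteq> S \<and> separator G X Y T}"
  have "finite S"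
    using assms finite_subset[OF _ finite_verts] unfolding separator_def by blast
  then obtain T where T: "T \<in> ?F" "\<forall>T' \<in> ?F. T' \<subseteq> T \<longrightarrow> T = T'"
    using finite_has_minimal[of ?F] assms by auto
  then have "minimal_separator G X Y T"
    unfolding minimal_separator_def by blast
  then show ?thesis
    using T(1) by blast
qed

context sym_digraph
begin

lemma reachable_del_verts_sym:
  assumes "x \<rightarrow>\<^sup>*\<^bsub>del_verts G S\<^esub> y"
  shows "y \<rightarrow>\<^sup>*\<^bsub>del_verts G S\<^esub> x"
proof -
  have "symmetric (del_verts G S)"
    using arcs_ends_symmetric[OF sym_arcs] unfolding symmetric_def
    by (intro symI) (simp add: dominates_del_verts_iff)
  then show ?thesis
    using assms by (rule symmetric_reachable)
qed

lemma separator_commute: "separator G X Y S \<longleftrightarrow> separator G Y X S"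
  unfolding separator_altdef using reachable_del_verts_sym[where S = S] by blast

lemma minimal_separator_commute: "minimal_separator G X Y S \<longleftrightarrow> minimal_separator G Y X S"
  unfolding minimal_separator_def separator_commute[of X] ..

lemma separator_iff_reach_avoiding_disjoint:
  "separator G X Y S \<longleftrightarrow> S \<subseteq> verts G \<and> reach_avoiding G Y S \<inter> X = {}"
proof -
  have "x \<in> reach_avoiding G Y S \<longleftrightarrow> (\<exists>y\<in>Y. y \<rightarrow>\<^sup>*\<^bsub>del_verts G S\<^esub> x)" for x
    using wf_digraph.reachable_in_verts[OF wf_digraph_del_verts[of S]]
    by (auto simp: reach_avoiding_def verts_del_verts)
  then have "separator G Y X S \<longleftrightarrow> S \<subseteq> verts G \<and> reach_avoiding G Y S \<inter> X = {}"
    unfolding separator_altdef by blast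
  then show ?thesis
    by (simp only: separator_commute[of X Y])
qed

lemma reach_avoiding_sides_disjoint:
  assumes "separator G X Y S"
  shows "reach_avoiding G X S \<inter> reach_avoiding G Y S = {}"
proof -
  have "x \<rightarrow>\<^sup>*\<^bsub>del_verts G S\<^esub> y"
    if "x \<rightarrow>\<^sup>*\<^bsub>del_verts G S\<^esub> v" "y \<rightarrow>\<^sup>*\<^bsub>del_verts G S\<^esub> v" for x y v
    using that(1) reachable_del_verts_sym[OF that(2)]
    by (rule wf_digraph.reachable_trans[OF wf_digraph_del_verts])
  then show ?thesis
    using assms unfolding separator_altdef reach_avoiding_def by blast
qed

end

locale terminals = graph G for G :: "('a, 'b) pre_digraph" (structure) +
  fixes X Y :: "'a set"
  assumes X_subset: "X \<subseteq> verts G" and Y_subset: "Y \<subseteq> verts G"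
begin

abbreviation outer_boundary :: "'a set \<Rightarrow> 'a set" where
  "outer_boundary \<equiv> boundary (reach_step G Y)"

lemma terminals_swap: "terminals G Y X"
  using X_subset Y_subset by unfold_locales

lemmas reach_avoiding_eq = reach_avoiding_eq_accessible_part[OF Y_subset]

lemma reach_avoiding_subset: "reach_avoiding G Y S \<subseteq> verts G - S"
  unfolding reach_avoiding_eq by (rule accessible_part_subset) simp

lemma reach_avoiding_antimono: "T \<subseteq> S \<Longrightarrow> reach_avoiding G Y S \<subseteq> reach_avoiding G Y T"
  unfolding reach_avoiding_eq by (rule accessible_part_mono) blast

lemma accessible_reach_avoiding: "accessible (reach_step G Y) {} (reach_avoiding G Y S)"
  unfolding reach_avoiding_eq by (rule accessible_accessible_part[OF mono_reach_step]) simp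

lemma accessible_subset_verts: "accessible (reach_step G Y) {} C \<Longrightarrow> C \<subseteq> verts G"
  using accessible_subset_step[OF mono_reach_step, of G Y "{}" C]
    reach_step_subset_verts[OF Y_subset, of C] by simp

lemma outer_boundary_subset_verts: "outer_boundary C \<subseteq> verts G"
  using reach_step_subset_verts[OF Y_subset] unfolding boundary_def by blast

lemma outer_boundary_reach_avoiding_subset: "outer_boundary (reach_avoiding G Y S) \<subseteq> S"
  using accessible_part_closed[OF mono_reach_step, of G Y "{}" "verts G - S"]
    reach_step_subset_verts[OF Y_subset]
  unfolding reach_avoiding_eq boundary_def by blast

lemma reach_avoiding_outer_boundary:
  "accessible (reach_step G Y) {} C \<Longrightarrow> reach_avoiding G Y (outer_boundary C) = C"
  unfolding reach_avoiding_eq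
  by (intro accessible_part_minus_boundary accessible_subset_verts)

lemma inj_on_outer_boundary: "inj_on outer_boundary {C. accessible (reach_step G Y) {} C}"
  by (rule inj_on_inverseI[of _ "reach_avoiding G Y"]) (simp add: reach_avoiding_outer_boundary)

lemma separator_outer_boundary:
  assumes "C \<inter> X = {}"
  shows "separator G X Y (outer_boundary C)"
proof -
  have "reach_avoiding G Y (outer_boundary C) \<subseteq> C"
    unfolding reach_avoiding_eq by (rule accessible_part_least) (auto simp: boundary_def)
  then show ?thesis
    using assms outer_boundary_subset_verts unfolding separator_iff_reach_avoiding_disjoint by blast
qed

lemma minimal_separator_eq_outer_boundary:
  assumes "minimal_separator G X Y S"
  shows "S = outer_boundary (reach_avoiding G Y S)"
proof -
  have "separator G X Y S"
    using assms unfolding minimal_separator_def by (rule conjunct1)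
  then have "separator G X Y (outer_boundary (reach_avoiding G Y S))"
    by (intro separator_outer_boundary) (simp add: separator_iff_reach_avoiding_disjoint)
  then show ?thesis
    using assms outer_boundary_reach_avoiding_subset[of S] unfolding minimal_separator_def by blast
qed

lemma reach_avoiding_other_side_antimono:
  assumes S: "minimal_separator G X Y S" and T: "separator G X Y T"
    and subset: "reach_avoiding G X S \<subseteq> reach_avoiding G X T"
  shows "reach_avoiding G Y T \<subseteq> reach_avoiding G Y S"
proof -
  interpret swap: terminals G Y X
    by (rule terminals_swap)
  have "S \<subseteq> reach_step G X (reach_avoiding G X S)"
    using swap.minimal_separator_eq_outer_boundary[of S] S minimal_separator_commute
    unfolding boundary_def by blast
  also have "\<dots> \<subseteq> reach_step G X (reach_avoiding G X T)"
    by (rule monoD[OF mono_reach_step subset])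
  also have "\<dots> \<subseteq> reach_avoiding G X T \<union> T"
    using swap.outer_boundary_reach_avoiding_subset[of T] unfolding boundary_def by blast
  finally have "reach_avoiding G Y T \<subseteq> verts G - S"
    using reach_avoiding_sides_disjoint[OF T] reach_avoiding_subset[of T] by blast
  with accessible_reach_avoiding show ?thesis
    unfolding reach_avoiding_eq[of S] by (rule accessible_subset_accessible_part)
qed

lemma sep_preceq_iff:
  assumes "minimal_separator G X Y S" "minimal_separator G X Y T"
  shows "sep_preceq G X S T \<longleftrightarrow> reach_avoiding G Y T \<subseteq> reach_avoiding G Y S"
proof -
  interpret swap: terminals G Y X
    by (rule terminals_swap)
  have "minimal_separator G Y X T" "separator G Y X S" "separator G X Y T"
    using assms minimal_separator_commute separator_commute minimal_separator_def by metis+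
  then show ?thesis
    using reach_avoiding_other_side_antimono[OF assms(1)]
      swap.reach_avoiding_other_side_antimono[of T S]
    unfolding sep_preceq_def by blast
qed

lemma leftmost_separator_iff:
  "leftmost_separator G X Y k S \<longleftrightarrow> minimal_separator_le G X Y k S \<and>
     (\<forall>T. minimal_separator_le G X Y k T \<and> reach_avoiding G Y S \<subseteq> reach_avoiding G Y T \<longrightarrow> T = S)"
  unfolding leftmost_separator_def minimal_separator_le_def using sep_preceq_iff by blast

lemma important_separator_iff:
  "important_separator G X Y k S \<longleftrightarrow> leftmost_separator G X Y (card S) S \<and> card S \<le> k"
proof -
  have "T = S" if "minimal_separator G X Y S" "minimal_separator G X Y T"
    "reach_avoiding G Y S = reach_avoiding G Y T" for T
    using that minimal_separator_eq_outer_boundary by metis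
  then show ?thesis
    unfolding important_separator_def leftmost_separator_iff minimal_separator_le_def
      sep_dominates_def
    by (auto simp: psubset_eq)
qed

abbreviation bounded_sides :: "nat \<Rightarrow> 'a set set" where
  "bounded_sides \<equiv> bounded_sets (reach_step G Y) {} (verts G - X)"

abbreviation leftmost_sides :: "nat \<Rightarrow> 'a set set" where
  "leftmost_sides \<equiv> maximal_bounded_sets (reach_step G Y) {} (verts G - X)"

lemma reach_avoiding_mem_bounded_sides:
  assumes "minimal_separator_le G X Y k S"
  shows "reach_avoiding G Y S \<in> bounded_sides k"
proof -
  have S: "minimal_separator G X Y S" "card S \<le> k"
    using assms unfolding minimal_separator_le_def by simp_all
  then have "reach_avoiding G Y S \<subseteq> verts G - X"
    using reach_avoiding_subset[of S]
    unfolding minimal_separator_def separator_iff_reach_avoiding_disjoint by blast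
  moreover have "card (outer_boundary (reach_avoiding G Y S)) \<le> k"
    using minimal_separator_eq_outer_boundary[OF S(1)] S(2) by simp
  ultimately show ?thesis
    using accessible_reach_avoiding unfolding bounded_sets_def by blast
qed

lemma minimal_separator_le_above:
  assumes "C \<in> bounded_sides k"
  obtains T where "minimal_separator_le G X Y k T" "C \<subseteq> reach_avoiding G Y T"
proof -
  note C = bounded_setsD[OF assms]
  obtain T where T: "T \<subseteq> outer_boundary C" "minimal_separator G X Y T"
    using minimal_separator_exists[OF separator_outer_boundary[of C]] C(1) by blast
  have "finite (outer_boundary C)"
    using outer_boundary_subset_verts finite_verts by (rule finite_subset)
  then have "card T \<le> card (outer_boundary C)"
    using T(1) by (rule card_mono)
  show ?thesis
  proof (rule that)
    show "minimal_separator_le G X Y k T"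
      using T(2) \<open>card T \<le> card (outer_boundary C)\<close> C(3) unfolding minimal_separator_le_def by simp
    show "C \<subseteq> reach_avoiding G Y T"
      using reach_avoiding_antimono[OF T(1)] reach_avoiding_outer_boundary[OF C(2)] by simp
  qed
qed

lemma reach_avoiding_mem_leftmost_sides:
  assumes "leftmost_separator G X Y k S"
  shows "reach_avoiding G Y S \<in> leftmost_sides k"
proof (rule maximal_bounded_setsI)
  have S: "minimal_separator_le G X Y k S"
    and maximal: "\<And>T. \<lbrakk>minimal_separator_le G X Y k T;
      reach_avoiding G Y S \<subseteq> reach_avoiding G Y T\<rbrakk> \<Longrightarrow> T = S"
    using assms unfolding leftmost_separator_iff by blast+
  show "reach_avoiding G Y S \<in> bounded_sides k"
    using S by (rule reach_avoiding_mem_bounded_sides)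
  fix D assume D: "D \<in> bounded_sides k" "reach_avoiding G Y S \<subseteq> D"
  obtain T where T: "minimal_separator_le G X Y k T" "D \<subseteq> reach_avoiding G Y T"
    using D(1) by (rule minimal_separator_le_above)
  then have "T = S"
    using D(2) by (intro maximal) simp_all
  then show "D = reach_avoiding G Y S"
    using D(2) T(2) by simp
qed

lemma leftmost_separator_outer_boundary:
  assumes "C \<in> leftmost_sides k"
  shows "leftmost_separator G X Y k (outer_boundary C)"
proof -
  note C = maximal_bounded_setsD[OF assms]
  have reach_C: "reach_avoiding G Y (outer_boundary C) = C"
    using C(1) by (intro reach_avoiding_outer_boundary bounded_setsD)
  have unique: "T = outer_boundary C"
    if T: "minimal_separator_le G X Y k T" "C \<subseteq> reach_avoiding G Y T" for T
  proof -
    have "reach_avoiding G Y T = C"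
      using reach_avoiding_mem_bounded_sides[OF T(1)] T(2) by (rule C(2))
    then show ?thesis
      using minimal_separator_eq_outer_boundary[of T] T(1) unfolding minimal_separator_le_def
      by simp
  qed
  obtain T where "minimal_separator_le G X Y k T" "C \<subseteq> reach_avoiding G Y T"
    using C(1) by (rule minimal_separator_le_above)
  then have "minimal_separator_le G X Y k (outer_boundary C)"
    using unique by metis
  then show ?thesis
    unfolding leftmost_separator_iff reach_C using unique by blast
qed

lemma leftmost_separators_eq:
  "{S. leftmost_separator G X Y k S} = outer_boundary ` leftmost_sides k"
proof (intro set_eqI iffI)
  fix S assume "S \<in> {S. leftmost_separator G X Y k S}"
  then have S: "leftmost_separator G X Y k S"
    by simp
  then have "S = outer_boundary (reach_avoiding G Y S)"
    by (intro minimal_separator_eq_outer_boundary)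
      (simp add: leftmost_separator_def minimal_separator_le_def)
  then show "S \<in> outer_boundary ` leftmost_sides k"
    using reach_avoiding_mem_leftmost_sides[OF S] by blast
qed (use leftmost_separator_outer_boundary in blast)

lemma card_leftmost_separators:
  "card {S. leftmost_separator G X Y k S} = card (leftmost_sides k)"
  unfolding leftmost_separators_eq
  by (intro card_image inj_on_subset[OF inj_on_outer_boundary])
    (auto dest: maximal_bounded_setsD bounded_setsD)

lemma finite_leftmost_separators: "finite {S. leftmost_separator G X Y k S}"
  unfolding leftmost_separators_eq
  by (intro finite_imageI finite_maximal_bounded_sets finite_Diff finite_verts)

lemma finite_expansion_reach_step: "finite_expansion (reach_step G Y) (verts G - X)"
proof
  show "reach_step G Y (C \<union> D) = reach_step G Y C \<union> reach_step G Y D" for C D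
    unfolding reach_step_def by blast
  show "finite (reach_step G Y (verts G - X))"
    using reach_step_subset_verts[OF Y_subset] finite_verts by (rule finite_subset)
qed simp

lemma boundaries_ge_1_if_not_separator_empty:
  assumes "\<not> separator G X Y {}"
  shows "boundaries_ge (reach_step G Y) {} (verts G - X) 1"
  unfolding boundaries_ge_def
proof (intro allI impI)
  fix C assume "{} \<subseteq> C \<and> C \<subseteq> verts G - X"
  then have "separator G X Y (outer_boundary C)"
    by (intro separator_outer_boundary) blast
  then have "outer_boundary C \<noteq> {}"
    using assms by metis
  moreover have "finite (outer_boundary C)"
    using outer_boundary_subset_verts finite_verts by (rule finite_subset)
  ultimately show "1 \<le> card (outer_boundary C)"
    by (simp add: Suc_le_eq card_gt_0_iff)
qed

lemma card_leftmost_separators_le: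
  "real (card {S. leftmost_separator G X Y (Suc n) S}) \<le> catalan n"
proof -
  have "card {S. leftmost_separator G X Y (Suc n) S} \<le> ballot n 1"
  proof (cases "separator G X Y {}")
    case True
    then have "{S. leftmost_separator G X Y (Suc n) S} \<subseteq> {{}}"
      using minimal_separator_eq_empty
      unfolding leftmost_separator_def minimal_separator_le_def by blast
    then have "card {S. leftmost_separator G X Y (Suc n) S} \<le> card {{} :: 'a set}"
      by (intro card_mono) simp_all
    then show ?thesis
      using ballot_pos[of 1 n] by simp
  next
    case False
    then have "card (leftmost_sides (n + 1)) \<le> ballot n 1"
      by (intro card_maximal_bounded_sets_le_ballot finite_expansion_reach_step
          boundaries_ge_1_if_not_separator_empty) simp_all
    then show ?thesis
      by (simp add: card_leftmost_separators)
  qed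
  then show ?thesis
    unfolding ballot_1_eq_catalan[symmetric] by (rule of_nat_mono)
qed

lemma important_separators_subset:
  "{S. important_separator G X Y (Suc n) S} \<subseteq> (\<Union>i\<le>n. {S. leftmost_separator G X Y (Suc i) S})"
proof
  fix S assume "S \<in> {S. important_separator G X Y (Suc n) S}"
  then have S: "leftmost_separator G X Y (card S) S" "card S \<le> Suc n"
    using important_separator_iff by simp_all
  show "S \<in> (\<Union>i\<le>n. {S. leftmost_separator G X Y (Suc i) S})"
  proof (cases "card S")
    case 0
    have "S \<subseteq> verts G"
      using S(1) unfolding leftmost_separator_def minimal_separator_le_def minimal_separator_def
        separator_def by simp
    then have "S = {}"
      using 0 finite_subset[OF _ finite_verts] by simp
    then have "leftmost_separator G X Y 1 S"
      using S(1) minimal_separator_eq_empty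
      unfolding leftmost_separator_def minimal_separator_le_def minimal_separator_def by auto
    then show ?thesis
      by auto
  next
    case (Suc i)
    then show ?thesis
      using S by auto
  qed
qed

lemma finite_important_separators: "finite {S. important_separator G X Y (Suc n) S}"
  by (rule finite_subset[OF important_separators_subset]) (simp add: finite_leftmost_separators)

lemma card_important_separators_le:
  "real (card {S. important_separator G X Y (Suc n) S}) \<le> (\<Sum>i=0..n. catalan i)"
proof -
  let ?L = "\<lambda>i. {S. leftmost_separator G X Y (Suc i) S}"
  have "card {S. important_separator G X Y (Suc n) S} \<le> card (\<Union>i\<le>n. ?L i)"
    by (intro card_mono important_separators_subset) (simp add: finite_leftmost_separators)
  also have "\<dots> \<le> (\<Sum>i\<le>n. card (?L i))"
    by (intro card_UN_le) simp
  finally have "real (card {S. important_separator G X Y (Suc n) S}) \<le> (\<Sum>i\<le>n. real (card (?L i)))"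
    by (simp flip: of_nat_sum)
  also have "\<dots> \<le> (\<Sum>i\<le>n. catalan i)"
    by (intro sum_mono card_leftmost_separators_le)
  finally show ?thesis
    by (simp add: atLeast0AtMost)
qed

end

section \<open>Subtrees of the infinite binary tree\<close>

text \<open>The node \<open>c > 0\<close> has the children \<open>2 * c\<close> and \<open>2 * c + 1\<close>; the root is \<open>1\<close>.\<close>

definition tree_step :: "nat set \<Rightarrow> nat set" where
  "tree_step C = insert 1 {c. c div 2 \<in> C}"

definition subtrees :: "nat \<Rightarrow> nat set set" where
  "subtrees n = {C. accessible tree_step {} C \<and> finite C \<and> card C = n}"

definition subtrees_above :: "nat set \<Rightarrow> nat set \<Rightarrow> nat \<Rightarrow> nat set set" where
  "subtrees_above B W n = {C \<in> subtrees (card B + n). B \<subseteq> C \<and> C \<inter> W = {}}"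

lemma mono_tree_step: "mono tree_step"
  unfolding tree_step_def by (intro monoI) blast

lemma accessible_tree_step_iff: "accessible tree_step {} C \<longleftrightarrow> 0 \<notin> C \<and> C \<subseteq> tree_step C"
proof
  assume acc: "accessible tree_step {} C"
  then have "C \<subseteq> - {0}"
    by (rule accessible_subset_closed) (auto simp: tree_step_def)
  then show "0 \<notin> C \<and> C \<subseteq> tree_step C"
    using accessible_subset_step[OF mono_tree_step acc] by auto
next
  assume C: "0 \<notin> C \<and> C \<subseteq> tree_step C"
  have "c \<in> accessible_part tree_step {} C" if "c \<in> C" for c
    using that
  proof (induction c rule: less_induct)
    case (less c)
    then have "0 < c" "c \<in> tree_step C"
      using C by (auto intro: gr0I)
    then have "c \<in> tree_step (accessible_part tree_step {} C)"
      using less.IH[of "c div 2"] unfolding tree_step_def by auto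
    then show ?case
      using less.prems accessible_part_closed[OF mono_tree_step, of "{}" C] by blast
  qed
  then show "accessible tree_step {} C"
    by (intro accessibleI) auto
qed

lemma tree_step_eq: "tree_step C = insert 1 ((\<lambda>c. 2 * c) ` C \<union> (\<lambda>c. 2 * c + 1) ` C)"
proof -
  have "c = 2 * (c div 2) \<or> c = 2 * (c div 2) + 1" for c :: nat
    by presburger
  then have "{c. c div 2 \<in> C} \<subseteq> (\<lambda>c. 2 * c) ` C \<union> (\<lambda>c. 2 * c + 1) ` C"
    by blast
  then show ?thesis
    unfolding tree_step_def by auto
qed

lemma finite_tree_step: "finite C \<Longrightarrow> finite (tree_step C)"
  unfolding tree_step_eq by simp

lemma card_tree_step:
  assumes "finite C" "0 \<notin> C"
  shows "card (tree_step C) = 2 * card C + 1"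
proof -
  have "(\<lambda>c. 2 * c) ` C \<inter> (\<lambda>c. 2 * c + 1) ` C = {}"
    by (auto, presburger)
  then have "card ((\<lambda>c. 2 * c) ` C \<union> (\<lambda>c. 2 * c + 1) ` C)
      = card ((\<lambda>c. 2 * c) ` C) + card ((\<lambda>c. 2 * c + 1) ` C)"
    using assms(1) by (intro card_Un_disjoint) simp_all
  also have "\<dots> = 2 * card C"
    by (simp add: card_image inj_on_def)
  finally have "card ((\<lambda>c. 2 * c) ` C \<union> (\<lambda>c. 2 * c + 1) ` C) = 2 * card C" .
  moreover have "1 \<notin> (\<lambda>c. 2 * c) ` C \<union> (\<lambda>c. 2 * c + 1) ` C"
    using assms(2) by auto
  ultimately show ?thesis
    unfolding tree_step_eq using assms(1) by simp
qed

lemma card_boundary_tree_step_ge: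
  assumes "finite C" "0 \<notin> C"
  shows "card C + 1 \<le> card (boundary tree_step C)"
  using diff_card_le_card_Diff[OF assms(1), of "tree_step C"] card_tree_step[OF assms]
  unfolding boundary_def by simp

lemma card_boundary_subtree:
  assumes "finite C" "accessible tree_step {} C"
  shows "card (boundary tree_step C) = card C + 1"
  using assms card_Diff_subset[OF assms(1), of "tree_step C"] card_tree_step[OF assms(1)]
  unfolding boundary_def accessible_tree_step_iff by simp

lemma subtrees_remove_Max:
  assumes "C \<in> subtrees (Suc n)"
  shows "C - {Max C} \<in> subtrees n"
proof -
  have C: "0 \<notin> C" "C \<subseteq> tree_step C" "finite C" "card C = Suc n"
    using assms unfolding subtrees_def accessible_tree_step_iff by simp_all
  then have "Max C \<in> C"
    by (intro Max_in) auto
  have "C - {Max C} \<subseteq> tree_step (C - {Max C})"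
  proof
    fix c assume c: "c \<in> C - {Max C}"
    then have "0 < c" "c \<le> Max C"
      using C(1,3) by (auto intro: gr0I)
    then have "c div 2 < Max C"
      by simp
    then show "c \<in> tree_step (C - {Max C})"
      using c C(2) unfolding tree_step_def by auto
  qed
  then show ?thesis
    using C \<open>Max C \<in> C\<close> unfolding subtrees_def accessible_tree_step_iff by simp
qed

lemma subtrees_subset: "C \<in> subtrees n \<Longrightarrow> C \<subseteq> {1..<2 ^ n}"
proof (induction n arbitrary: C)
  case 0
  then show ?case
    unfolding subtrees_def by auto
next
  case (Suc n)
  let ?m = "Max C"
  have IH: "C - {?m} \<subseteq> {1..<2 ^ n}"
    using Suc.prems by (intro Suc.IH subtrees_remove_Max)
  have C: "0 \<notin> C" "C \<subseteq> tree_step C" "finite C" "C \<noteq> {}"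
    using Suc.prems unfolding subtrees_def accessible_tree_step_iff by auto
  have "?m \<in> C"
    using C(3,4) by (rule Max_in)
  moreover from this have "0 < ?m"
    using C(1) by (metis gr0I)
  ultimately have "?m = 1 \<or> ?m div 2 \<in> C - {?m}"
    using C(2) unfolding tree_step_def by auto
  then have "?m < 2 ^ Suc n"
  proof
    assume "?m = 1"
    then show ?thesis
      using one_less_power[of "2 :: nat" "Suc n"] by simp
  next
    assume "?m div 2 \<in> C - {?m}"
    then have "?m div 2 < 2 ^ n"
      using IH by auto
    then show ?thesis
      by simp
  qed
  then show ?case
    using IH \<open>0 < ?m\<close> by fastforce
qed

lemma finite_subtrees: "finite (subtrees n)"
proof (rule finite_subset)
  show "subtrees n \<subseteq> Pow {1..<2 ^ n}"
    using subtrees_subset by blast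
qed simp

lemma subtrees_above_0:
  assumes "finite B" "accessible tree_step {} B" "B \<inter> W = {}"
  shows "subtrees_above B W 0 = {B}"
proof -
  have "C = B" if "C \<in> subtrees (card B)" "B \<subseteq> C" for C
    by (rule card_subset_eq[symmetric]) (use that in \<open>simp_all add: subtrees_def\<close>)
  then show ?thesis
    using assms unfolding subtrees_above_def by (auto simp: subtrees_def)
qed

lemma subtrees_above_boundary:
  assumes "finite B"
  shows "subtrees_above B (boundary tree_step B) (Suc n) = {}"
proof -
  have False if "C \<in> subtrees (card B + Suc n)" "C \<inter> boundary tree_step B = {}" for C
  proof -
    have C: "accessible tree_step {} C" "card C = card B + Suc n"
      using that(1) unfolding subtrees_def by simp_all
    have "C \<subseteq> B"
      using C(1) empty_subsetI that(2) by (rule accessible_subset_if_disjoint_boundary)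
    then show False
      using card_mono[OF assms, of C] C(2) by simp
  qed
  then show ?thesis
    unfolding subtrees_above_def by blast
qed

lemma card_subtrees_above_Suc:
  assumes "finite B" "v \<notin> B" "v \<notin> W"
  shows "card (subtrees_above B W (Suc n))
    = card (subtrees_above B (insert v W) (Suc n)) + card (subtrees_above (insert v B) W n)"
proof -
  have "subtrees_above B W (Suc n)
      = subtrees_above B (insert v W) (Suc n) \<union> subtrees_above (insert v B) W n"
    using assms unfolding subtrees_above_def by auto
  moreover have "finite (subtrees_above B' W' m)" for B' W' m
    using finite_subtrees unfolding subtrees_above_def by simp
  moreover have "subtrees_above B (insert v W) (Suc n) \<inter> subtrees_above (insert v B) W n = {}"
    unfolding subtrees_above_def by blast
  ultimately show ?thesis
    by (simp add: card_Un_disjoint)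
qed

text \<open>
  Decide one node \<open>v\<close> of the boundary of \<open>B\<close> after the other: \<open>W\<close> holds the excluded ones, and
  including \<open>v\<close> puts its two children on the boundary. This is the recursion of \<open>ballot\<close>.
\<close>

lemma card_subtrees_above:
  assumes "finite B" "accessible tree_step {} B" "W \<subseteq> boundary tree_step B"
    and "card W + l = card B + 1"
  shows "card (subtrees_above B W n) = ballot n l"
  using assms
proof (induction n l arbitrary: B W rule: ballot.induct)
  case (1 l)
  then have "subtrees_above B W 0 = {B}"
    by (intro subtrees_above_0) (auto simp: boundary_def)
  then show ?case by simp
next
  case (2 n)
  have "card W = card (boundary tree_step B)"
    using card_boundary_subtree[OF "2.prems"(1,2)] "2.prems"(4) by simp
  then have "W = boundary tree_step B"
    using finite_tree_step[OF "2.prems"(1)] "2.prems"(3)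
    by (intro card_subset_eq) (simp_all add: boundary_def)
  then show ?case
    using subtrees_above_boundary[OF "2.prems"(1)] by simp
next
  case (3 n l)
  note B = "3.prems"(1,2) and W = "3.prems"(3,4)
  have "finite W"
    using finite_subset[OF W(1)] finite_tree_step[OF B(1)] unfolding boundary_def by simp
  have "card W < card (boundary tree_step B)"
    using card_boundary_subtree[OF B] W(2) by simp
  then obtain v where v: "v \<in> boundary tree_step B" "v \<notin> W"
    using card_mono[OF \<open>finite W\<close>, of "boundary tree_step B"] not_le by blast
  then have "v \<notin> B" "v \<in> tree_step B"
    unfolding boundary_def by simp_all
  have "W \<subseteq> boundary tree_step (insert v B)"
    using W(1) v(2) monoD[OF mono_tree_step, of B "insert v B"] unfolding boundary_def by blast
  then have included: "card (subtrees_above (insert v B) W n) = ballot n (l + 2)"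
    using B W(2) \<open>v \<notin> B\<close> \<open>v \<in> tree_step B\<close>
    by (intro "3.IH"(2) accessible_insert mono_tree_step) simp_all
  have excluded: "card (subtrees_above B (insert v W) (Suc n)) = ballot (Suc n) l"
    using W v \<open>finite W\<close> by (intro "3.IH"(1) B) simp_all
  show ?case
    using card_subtrees_above_Suc[OF B(1) \<open>v \<notin> B\<close> v(2)] included excluded by simp
qed

lemma card_subtrees: "real (card (subtrees n)) = catalan n"
  using card_subtrees_above[of "{}" "{}" 1 n]
  unfolding ballot_1_eq_catalan[symmetric] subtrees_above_def
  by (simp add: accessible_tree_step_iff)

section \<open>The complete binary tree\<close>

definition binary_tree :: "nat \<Rightarrow> (nat, nat \<times> nat) pre_digraph" where
  "binary_tree k = \<lparr>verts = {1..<2 ^ (k + 1)},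
     arcs = {(u, v). u \<in> {1..<2 ^ (k + 1)} \<and> v \<in> {1..<2 ^ (k + 1)} \<and> (u div 2 = v \<or> v div 2 = u)},
     tail = fst, head = snd\<rparr>"

definition leaves :: "nat \<Rightarrow> nat set" where
  "leaves k = {2 ^ k..<2 ^ (k + 1)}"

lemma graph_binary_tree: "graph (binary_tree k)"
proof unfold_locales
  have "arcs (binary_tree k) \<subseteq> {1..<2 ^ (k + 1)} \<times> {1..<2 ^ (k + 1)}"
    unfolding binary_tree_def by auto
  then show "finite (arcs (binary_tree k))"
    by (rule finite_subset) simp
  show "symmetric (binary_tree k)"
    unfolding symmetric_conv binary_tree_def by auto
qed (auto simp: binary_tree_def arc_to_ends_def)

lemma dominates_binary_tree_iff:
  "u \<rightarrow>\<^bsub>binary_tree k\<^esub> v \<longleftrightarrow>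
     u \<in> {1..<2 ^ (k + 1)} \<and> v \<in> {1..<2 ^ (k + 1)} \<and> (u div 2 = v \<or> v div 2 = u)"
  unfolding arcs_ends_conv binary_tree_def by (auto simp: image_iff)

lemma verts_binary_tree_minus_leaves: "verts (binary_tree k) - leaves k = {1..<2 ^ k}"
  unfolding binary_tree_def leaves_def by auto

lemma terminals_binary_tree: "terminals (binary_tree k) (leaves k) {1}"
proof -
  have "(1 :: nat) < 2 ^ (k + 1)"
    by (rule one_less_power) auto
  then show ?thesis
    unfolding terminals_def terminals_axioms_def using graph_binary_tree
    by (auto simp: binary_tree_def leaves_def intro: le_trans[of 1 "2 ^ k"])
qed

lemma tree_step_subset_reach_step:
  assumes "C \<subseteq> {1..<2 ^ k}"
  shows "tree_step C \<subseteq> reach_step (binary_tree k) {1} C"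
proof
  fix c assume "c \<in> tree_step C"
  then consider "c = 1" | "c div 2 \<in> C"
    unfolding tree_step_def by blast
  then show "c \<in> reach_step (binary_tree k) {1} C"
  proof cases
    case 2
    then have "c div 2 \<in> {1..<2 ^ k}"
      using assms by blast
    then have "(c div 2) \<rightarrow>\<^bsub>binary_tree k\<^esub> c"
      unfolding dominates_binary_tree_iff by auto
    then show ?thesis
      using 2 unfolding reach_step_def by blast
  qed (simp add: reach_step_def)
qed

lemma boundary_reach_step_subtree:
  assumes "accessible tree_step {} C" "C \<subseteq> {1..<2 ^ k}"
  shows "boundary (reach_step (binary_tree k) {1}) C = boundary tree_step C"
proof
  show "boundary (reach_step (binary_tree k) {1}) C \<subseteq> boundary tree_step C"
    using assms(1) unfolding accessible_tree_step_iff boundary_def reach_step_def tree_step_def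
    by (fastforce simp: dominates_binary_tree_iff)
  show "boundary tree_step C \<subseteq> boundary (reach_step (binary_tree k) {1}) C"
    using tree_step_subset_reach_step[OF assms(2)] unfolding boundary_def by blast
qed

lemma accessible_reach_step_subtree:
  assumes "accessible tree_step {} C" "C \<subseteq> {1..<2 ^ k}"
  shows "accessible (reach_step (binary_tree k) {1}) {} C"
proof (rule accessible_mono_step[OF mono_reach_step assms(1)])
  fix D assume "D \<subseteq> C"
  then show "tree_step D \<inter> C \<subseteq> reach_step (binary_tree k) {1} D"
    using tree_step_subset_reach_step[of D k] assms(2) by blast
qed

lemma subtree_in_binary_tree:
  assumes "C \<in> subtrees n" "n \<le> k"
  shows "C \<subseteq> {1..<2 ^ k}" "accessible (reach_step (binary_tree k) {1}) {} C"
    and "card (boundary (reach_step (binary_tree k) {1}) C) = Suc n"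
proof -
  have C: "accessible tree_step {} C" "finite C" "card C = n"
    using assms(1) unfolding subtrees_def by simp_all
  have "{1..<2 ^ n} \<subseteq> {1..<(2 :: nat) ^ k}"
    using power_increasing[OF assms(2), of "2 :: nat"] by simp
  with subtrees_subset[OF assms(1)] show sub: "C \<subseteq> {1..<2 ^ k}"
    by (rule subset_trans)
  show "accessible (reach_step (binary_tree k) {1}) {} C"
    using C(1) sub by (rule accessible_reach_step_subtree)
  show "card (boundary (reach_step (binary_tree k) {1}) C) = Suc n"
    unfolding boundary_reach_step_subtree[OF C(1) sub] using card_boundary_subtree C by simp
qed

lemma card_less_boundary_reach_step:
  assumes "D \<subseteq> {1..<2 ^ k}"
  shows "card D < card (boundary (reach_step (binary_tree k) {1}) D)"
proof -
  interpret terminals "binary_tree k" "leaves k" "{1}"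
    by (rule terminals_binary_tree)
  have "card D + 1 \<le> card (boundary tree_step D)"
    using assms by (intro card_boundary_tree_step_ge) (auto intro: finite_subset)
  also have "\<dots> \<le> card (outer_boundary D)"
    using tree_step_subset_reach_step[OF assms]
    by (intro card_mono finite_subset[OF outer_boundary_subset_verts]) (auto simp: boundary_def)
  finally show ?thesis
    by simp
qed

lemma subtree_mem_maximal_bounded_sets:
  assumes "C \<in> subtrees n" "n \<le> k"
  shows "C \<in> maximal_bounded_sets (reach_step (binary_tree k) {1}) {} {1..<2 ^ k} (Suc n)"
proof (rule maximal_bounded_setsI)
  note C = subtree_in_binary_tree[OF assms]
  show "C \<in> bounded_sets (reach_step (binary_tree k) {1}) {} {1..<2 ^ k} (Suc n)"
    using C unfolding bounded_sets_def by simp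
  fix D assume D: "D \<in> bounded_sets (reach_step (binary_tree k) {1}) {} {1..<2 ^ k} (Suc n)" "C \<subseteq> D"
  note D_bounded = bounded_setsD[OF D(1)]
  have "card D \<le> card C"
    using card_less_boundary_reach_step[OF D_bounded(1)] D_bounded(3) assms(1)
    unfolding subtrees_def by simp
  then show "D = C"
    using card_seteq[OF finite_subset[OF D_bounded(1)] D(2)] by simp
qed

lemma card_leftmost_separators_binary_tree:
  "real (card {S. leftmost_separator (binary_tree n) (leaves n) {1} (Suc n) S}) = catalan n"
proof -
  interpret terminals "binary_tree n" "leaves n" "{1}"
    by (rule terminals_binary_tree)
  have "subtrees n \<subseteq> leftmost_sides (Suc n)"
    unfolding verts_binary_tree_minus_leaves using subtree_mem_maximal_bounded_sets by blast
  then have "card (subtrees n) \<le> card (leftmost_sides (Suc n))"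
    by (intro card_mono finite_maximal_bounded_sets finite_Diff finite_verts)
  then have "catalan n
      \<le> real (card {S. leftmost_separator (binary_tree n) (leaves n) {1} (Suc n) S})"
    unfolding card_leftmost_separators card_subtrees[symmetric] by (rule of_nat_mono)
  then show ?thesis
    using card_leftmost_separators_le[of n] by (rule antisym[rotated])
qed

lemma card_important_separators_binary_tree:
  "real (card {S. important_separator (binary_tree n) (leaves n) {1} (Suc n) S})
    = (\<Sum>i=0..n. catalan i)"
proof -
  interpret terminals "binary_tree n" "leaves n" "{1}"
    by (rule terminals_binary_tree)
  let ?T = "\<Union>i\<in>{0..n}. subtrees i"
  let ?I = "{S. important_separator (binary_tree n) (leaves n) {1} (Suc n) S}"
  have "outer_boundary ` ?T \<subseteq> ?I"
  proof clarify
    fix i C assume "i \<in> {0..n}" and C: "C \<in> subtrees i"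
    then have "i \<le> n"
      by simp
    have "C \<in> leftmost_sides (Suc i)"
      unfolding verts_binary_tree_minus_leaves using C \<open>i \<le> n\<close>
      by (rule subtree_mem_maximal_bounded_sets)
    then show "important_separator (binary_tree n) (leaves n) {1} (Suc n) (outer_boundary C)"
      unfolding important_separator_iff subtree_in_binary_tree(3)[OF C \<open>i \<le> n\<close>]
      using leftmost_separator_outer_boundary \<open>i \<le> n\<close> by simp
  qed
  moreover have "inj_on outer_boundary ?T"
    using subtree_in_binary_tree(2)[of _ _ n]
    by (intro inj_on_subset[OF inj_on_outer_boundary]) auto
  ultimately have "card ?T \<le> card ?I"
    using finite_important_separators by (intro card_inj_on_le)
  moreover have "card ?T = (\<Sum>i=0..n. card (subtrees i))"
    using finite_subtrees by (intro card_UN_disjoint) (auto simp: subtrees_def)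
  ultimately have "(\<Sum>i=0..n. catalan i) \<le> real (card ?I)"
    by (simp flip: card_subtrees of_nat_sum)
  then show ?thesis
    using card_important_separators_le[of n] by linarith
qed

theorem theorem6:
  fixes k :: nat
  assumes "k \<ge> 1"
  shows
    "(\<forall>(G :: ('a, 'b) pre_digraph) X Y. graph G \<and> X \<subseteq> verts G \<and> Y \<subseteq> verts G \<longrightarrow>
        real (card {S. leftmost_separator G X Y k S}) \<le> catalan (k - 1) \<and>
        real (card {S. important_separator G X Y k S}) \<le> (\<Sum>i=0..k-1. catalan i)) \<and>
     (\<exists>(G :: (nat, nat \<times> nat) pre_digraph) X Y. graph G \<and> X \<subseteq> verts G \<and> Y \<subseteq> verts G \<and>
        real (card {S. leftmost_separator G X Y k S}) = catalan (k - 1)) \<and>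
     (\<exists>(G :: (nat, nat \<times> nat) pre_digraph) X Y. graph G \<and> X \<subseteq> verts G \<and> Y \<subseteq> verts G \<and>
        real (card {S. important_separator G X Y k S}) = (\<Sum>i=0..k-1. catalan i))"
proof -
  obtain n where k: "k = Suc n"
    using assms by (cases k) auto
  have upper: "real (card {S. leftmost_separator G X Y k S}) \<le> catalan n \<and>
      real (card {S. important_separator G X Y k S}) \<le> (\<Sum>i=0..n. catalan i)"
    if "graph G \<and> X \<subseteq> verts G \<and> Y \<subseteq> verts G" for G :: "('a, 'b) pre_digraph" and X Y
  proof -
    interpret terminals G X Y
      using that by (intro terminals.intro terminals_axioms.intro) simp_all
    show ?thesis
      unfolding k using card_leftmost_separators_le card_important_separators_le by simp
  qed
  have tree: "graph (binary_tree n)" "leaves n \<subseteq> verts (binary_tree n)"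
    "{1} \<subseteq> verts (binary_tree n)"
    using terminals_binary_tree[of n] unfolding terminals_def terminals_axioms_def by simp_all
  show ?thesis
    unfolding k diff_Suc_1
    by (intro conjI exI[of _ "binary_tree n"] exI[of _ "leaves n"] exI[of _ "{1}"] tree
        card_leftmost_separators_binary_tree card_important_separators_binary_tree)
      (use upper[unfolded k] in blast)
qed

end
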